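(* Let $p>1$, $\beta=1/(p-1)$, and let $u_0\in C(\overline H)$ be such that $x_n^{-\beta-1}u_0(x)\to\infty$ as $x_n\to\infty$, uniformly with respect to $x'\in\mathbb{R}^{n-1}$. Let $T>0$. Then there is no nonnegative classical solution $u$ in the class $C^{2,1}(Q_T)\cap C(\overline{Q}_T)$ of the problem $$\begin{cases}u_t-\Delta u=|\nabla u|^p,& x\in H,\ t\in(0,T),\\ u=0,& x\in\partial H,\ t\in(0,T),\\ u(x,0)=u_0(x),& x\in H.\end{cases}$$
   Context: $H:=\mathbb{R}^n_+=\{x=(x',x_n)\in\mathbb{R}^{n-1}\times\mathbb{R}:\ x_n>0\}$ and $Q_T:=H\times(0,T)$, so that $\overline{Q}_T=\overline H\times[0,T]$. *)

theory Defs
  imports "HOL-Analysis.Analysis"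
begin

text \<open>
  The space \<open>R^n\<close>, \<open>n \<ge> 1\<close>, is \<^typ>\<open>real ^ 'n\<close>. The index type carries no order, so the coordinate
  written \<open>x\<^sub>n\<close> on paper is an arbitrary fixed index \<open>k\<close>; the remaining coordinates form \<open>x'\<close>.
  Functions of space and time have type \<^typ>\<open>(real ^ 'n) \<times> real \<Rightarrow> real\<close>; only their
  values on \<open>closure H \<times> {0..T}\<close> matter.
\<close>

definition half_space :: "'n \<Rightarrow> (real ^ 'n) set" where
  "half_space k = {x. x $ k > 0}"

definition cylinder :: "'n \<Rightarrow> real \<Rightarrow> ((real ^ 'n) \<times> real) set" where
  "cylinder k T = half_space k \<times> {0<..<T}"

definition closed_cylinder :: "'n::finite \<Rightarrow> real \<Rightarrow> ((real ^ 'n) \<times> real) set" where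
  "closed_cylinder k T = closure (half_space k) \<times> {0..T}"

subsection \<open>Classical partial derivatives\<close>

text \<open>The library constant \<^const>\<open>deriv\<close> is unspecified where the derivative does not exist;
  existence is stated separately by \<open>has_pdx\<close> and inside \<open>C21_on\<close>.\<close>

definition has_pdx :: "'n::finite \<Rightarrow> (real ^ 'n \<Rightarrow> real) \<Rightarrow> real ^ 'n \<Rightarrow> bool" where
  "has_pdx i f x \<longleftrightarrow> (\<lambda>s. f (x + s *\<^sub>R axis i 1)) field_differentiable (at 0)"

definition pdx :: "'n::finite \<Rightarrow> (real ^ 'n \<Rightarrow> real) \<Rightarrow> real ^ 'n \<Rightarrow> real" where
  "pdx i f x = deriv (\<lambda>s. f (x + s *\<^sub>R axis i 1)) 0"

definition gradient :: "(real ^ 'n::finite \<Rightarrow> real) \<Rightarrow> real ^ 'n \<Rightarrow> real ^ 'n" where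
  "gradient f x = (\<chi> i. pdx i f x)"

definition laplacian :: "(real ^ 'n::finite \<Rightarrow> real) \<Rightarrow> real ^ 'n \<Rightarrow> real" where
  "laplacian f x = (\<Sum>i\<in>UNIV. pdx i (pdx i f) x)"

definition time_deriv :: "((real ^ 'n) \<times> real \<Rightarrow> real) \<Rightarrow> real ^ 'n \<Rightarrow> real \<Rightarrow> real" where
  "time_deriv u x t = deriv (\<lambda>s. u (x, s)) t"

text \<open>The class \<open>C^{2,1}(Q)\<close>, intended for open \<open>Q\<close>: \<open>u\<close>, \<open>u\<^sub>t\<close> and all first and second order
  space derivatives (mixed ones included) exist and are jointly continuous on \<open>Q\<close>.\<close>

definition C21_on ::
    "((real ^ 'n::finite) \<times> real) set \<Rightarrow> ((real ^ 'n) \<times> real \<Rightarrow> real) \<Rightarrow> bool" where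
  "C21_on Q u \<longleftrightarrow>
     continuous_on Q u \<and>
     (\<forall>(x, t)\<in>Q. (\<lambda>s. u (x, s)) field_differentiable (at t)) \<and>
     continuous_on Q (\<lambda>(x, t). time_deriv u x t) \<and>
     (\<forall>i. (\<forall>(x, t)\<in>Q. has_pdx i (\<lambda>y. u (y, t)) x) \<and>
          continuous_on Q (\<lambda>(x, t). pdx i (\<lambda>y. u (y, t)) x)) \<and>
     (\<forall>i j. (\<forall>(x, t)\<in>Q. has_pdx j (pdx i (\<lambda>y. u (y, t))) x) \<and>
          continuous_on Q (\<lambda>(x, t). pdx j (pdx i (\<lambda>y. u (y, t))) x))"

subsection \<open>The initial-boundary value problem\<close>

definition classical_solution ::
    "'n::finite \<Rightarrow> real \<Rightarrow> real \<Rightarrow> (real ^ 'n \<Rightarrow> real) \<Rightarrow> ((real ^ 'n) \<times> real \<Rightarrow> real) \<Rightarrow> bool" where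
  "classical_solution k p T u0 u \<longleftrightarrow>
     C21_on (cylinder k T) u \<and>
     continuous_on (closed_cylinder k T) u \<and>
     (\<forall>x\<in>half_space k. \<forall>t\<in>{0<..<T}.
        time_deriv u x t - laplacian (\<lambda>y. u (y, t)) x = norm (gradient (\<lambda>y. u (y, t)) x) powr p) \<and>
     (\<forall>x\<in>frontier (half_space k). \<forall>t\<in>{0<..<T}. u (x, t) = 0) \<and>
     (\<forall>x\<in>half_space k. u (x, 0) = u0 x)"

text \<open>Divergence \<open>g(x) \<rightarrow> \<infinity>\<close> as \<open>x\<^sub>n \<rightarrow> \<infinity>\<close>, uniformly in \<open>x'\<close>: the threshold \<open>R\<close> on \<open>x\<^sub>n\<close> does not
  depend on the other coordinates.\<close>

definition tends_to_infinity_unif :: "'n \<Rightarrow> (real ^ 'n \<Rightarrow> real) \<Rightarrow> bool" where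
  "tends_to_infinity_unif k g \<longleftrightarrow>
     (\<forall>M. \<exists>R. \<forall>x\<in>half_space k. x $ k \<ge> R \<longrightarrow> g x \<ge> M)"

end

theory Submission
  imports Defs
begin

text \<open>
  With \<open>q = \<beta> + 1\<close>, the scaling \<open>u = X powr q * w\<close>, \<open>x = X * y\<close> leaves the Hamilton-Jacobi part
  \<open>u\<^sub>t = \<bar>\<nabla>u\<bar>\<^sup>p\<close> invariant without rescaling time and multiplies the diffusion by \<open>1 / X\<^sup>2\<close>. Since
  \<open>w \<ge> M\<close> initially on a ball of radius \<open>1/2\<close> about \<open>e\<^sub>k\<close>, a spreading paraboloid
  \<open>m t - g t * \<bar>y - e\<^sub>k\<bar>\<^sup>2\<close>, with \<open>m\<close> and \<open>g\<close> linear and decreasing in time, is a strict subsolution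
  where it is positive, and its positivity set grows until it touches the boundary of the half-space
  at a prescribed time \<open>t\<^sub>0\<close>. Its support is compact, so comparison with \<open>u \<ge> 0\<close> needs no growth
  condition. As its slope at the touching point is of order \<open>1\<close>, undoing the scaling gives
  \<open>u (e\<^sub>k, t\<^sub>0) \<ge> c * X powr (q - 1)\<close> for all large \<open>X\<close>, which is absurd.
\<close>

lemma local_min_imp_second_deriv_nonneg:
  fixes f f' :: "real \<Rightarrow> real"
  assumes "r > 0"
    and deriv: "\<And>s. \<bar>s - x\<bar> < r \<Longrightarrow> (f has_real_derivative f' s) (at s)"
    and second: "(f' has_real_derivative D) (at x)"
    and min: "\<And>s. \<bar>s - x\<bar> < r \<Longrightarrow> f x \<le> f s"
  shows "f' x = 0" and "D \<ge> 0"
proof -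
  show zero: "f' x = 0"
    using DERIV_local_min[OF deriv[of x] \<open>r > 0\<close>] min \<open>r > 0\<close>
    by (simp add: abs_minus_commute)
  show "D \<ge> 0"
  proof (rule ccontr)
    assume "\<not> D \<ge> 0"
    then obtain d where d: "d > 0" "\<And>h. h > 0 \<Longrightarrow> h < d \<Longrightarrow> f' (x + h) < f' x"
      using DERIV_neg_dec_right[OF second] by auto
    define h where "h = min d r / 2"
    have h: "0 < h" "h < d" "h < r"
      using d(1) \<open>r > 0\<close> by (auto simp: h_def min_def)
    obtain \<xi> where \<xi>: "x < \<xi>" "\<xi> < x + h" "f (x + h) - f x = (x + h - x) * f' \<xi>"
      using MVT2[of x "x + h" f f'] deriv h by auto
    have "f' \<xi> < 0"
      using d(2)[of "\<xi> - x"] \<xi> h zero by simp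
    then have "f (x + h) < f x"
      using \<xi>(3) h mult_pos_neg[of h "f' \<xi>"] by simp
    then show False
      using min[of "x + h"] h by simp
  qed
qed

lemma has_pdx_imp_DERIV:
  assumes "has_pdx i f (x + s *\<^sub>R axis i 1)"
  shows "((\<lambda>s. f (x + s *\<^sub>R axis i 1)) has_real_derivative pdx i f (x + s *\<^sub>R axis i 1)) (at s)"
proof -
  have "((\<lambda>h. f (x + s *\<^sub>R axis i 1 + h *\<^sub>R axis i 1)) has_real_derivative
      pdx i f (x + s *\<^sub>R axis i 1)) (at 0)"
    using assms unfolding has_pdx_def pdx_def
    by (metis field_differentiable_derivI)
  then have "((\<lambda>h. f (x + (h + s) *\<^sub>R axis i 1)) has_real_derivative
      pdx i f (x + s *\<^sub>R axis i 1)) (at 0)"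
    by (simp add: algebra_simps scaleR_add_left)
  then show ?thesis
    using DERIV_shift[of "\<lambda>s. f (x + s *\<^sub>R axis i 1)" _ 0 s] by simp
qed

lemma norm_add_scaleR_axis_sq:
  fixes d :: "real ^ 'n::finite"
  shows "(norm (d + s *\<^sub>R axis i 1))\<^sup>2 = (norm d)\<^sup>2 + 2 * s * d $ i + s\<^sup>2"
  unfolding power2_norm_eq_inner
  by (simp add: inner_add_left inner_add_right inner_axis inner_axis' algebra_simps power2_eq_square)

lemma pdx_touching_paraboloid:
  fixes f :: "real ^ 'n::finite \<Rightarrow> real"
  assumes "r > 0"
    and diff: "\<And>y. y \<in> ball x r \<Longrightarrow> has_pdx i f y"
    and diff2: "has_pdx i (pdx i f) x"
    and touch: "\<And>y. y \<in> ball x r \<Longrightarrow> f x + C * (norm (x - z))\<^sup>2 \<le> f y + C * (norm (y - z))\<^sup>2"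
  shows "pdx i f x = - 2 * C * (x - z) $ i" and "pdx i (pdx i f) x \<ge> - 2 * C"
proof -
  let ?e = "axis i 1 :: real ^ 'n"
  define \<phi> where "\<phi> s = f (x + s *\<^sub>R ?e) + C * ((norm (x - z))\<^sup>2 + 2 * s * (x - z) $ i + s\<^sup>2)" for s
  define \<phi>' where "\<phi>' s = pdx i f (x + s *\<^sub>R ?e) + C * (2 * (x - z) $ i + 2 * s)" for s
  have ball: "x + s *\<^sub>R ?e \<in> ball x r" if "\<bar>s - 0\<bar> < r" for s
    using that by (simp add: dist_norm)
  have 1: "(\<phi> has_real_derivative \<phi>' s) (at s)" if "\<bar>s - 0\<bar> < r" for s
    unfolding \<phi>_def \<phi>'_def
    by (intro DERIV_add has_pdx_imp_DERIV diff ball that) (auto intro!: derivative_eq_intros)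
  have 2: "(\<phi>' has_real_derivative pdx i (pdx i f) x + 2 * C) (at 0)"
    unfolding \<phi>'_def
    using has_pdx_imp_DERIV[of i "pdx i f" x 0] diff2
    by (intro DERIV_add) (auto intro!: derivative_eq_intros)
  have 3: "\<phi> 0 \<le> \<phi> s" if "\<bar>s - 0\<bar> < r" for s
  proof -
    have "x + s *\<^sub>R ?e - z = (x - z) + s *\<^sub>R ?e"
      by simp
    then show ?thesis
      using touch[OF ball[OF that]] by (simp only: \<phi>_def norm_add_scaleR_axis_sq) simp
  qed
  show "pdx i f x = - 2 * C * (x - z) $ i" "pdx i (pdx i f) x \<ge> - 2 * C"
    using local_min_imp_second_deriv_nonneg[OF \<open>r > 0\<close> 1 2 3]
    by (simp_all add: \<phi>'_def algebra_simps)
qed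

lemma gradient_laplacian_touching_paraboloid:
  fixes f :: "real ^ 'n::finite \<Rightarrow> real"
  assumes "r > 0"
    and "\<And>i y. y \<in> ball x r \<Longrightarrow> has_pdx i f y"
    and "\<And>i. has_pdx i (pdx i f) x"
    and "\<And>y. y \<in> ball x r \<Longrightarrow> f x + C * (norm (x - z))\<^sup>2 \<le> f y + C * (norm (y - z))\<^sup>2"
  shows "gradient f x = (- 2 * C) *\<^sub>R (x - z)"
    and "laplacian f x \<ge> - 2 * C * real CARD('n)"
proof -
  note touch = pdx_touching_paraboloid[OF assms(1,2,3,4)]
  show "gradient f x = (- 2 * C) *\<^sub>R (x - z)"
    unfolding gradient_def vec_eq_iff using touch(1) by simp
  have "(\<Sum>i\<in>(UNIV :: 'n set). - 2 * C) \<le> laplacian f x"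
    unfolding laplacian_def by (rule sum_mono) (rule touch(2))
  then show "laplacian f x \<ge> - 2 * C * real CARD('n)"
    by (simp add: mult.commute)
qed

lemma DERIV_le_of_left_min:
  fixes f g :: "real \<Rightarrow> real"
  assumes "r > 0"
    and f: "(f has_real_derivative a) (at t)" and g: "(g has_real_derivative b) (at t)"
    and min: "\<And>s. t - r < s \<Longrightarrow> s \<le> t \<Longrightarrow> f t - g t \<le> f s - g s"
  shows "a \<le> b"
proof (rule ccontr)
  assume "\<not> a \<le> b"
  then have pos: "a - b > 0"
    by simp
  have "((\<lambda>s. f s - g s) has_real_derivative a - b) (at t)"
    by (intro DERIV_diff f g)
  from DERIV_pos_inc_left[OF this pos] obtain d where d: "d > 0" "\<And>h. h > 0 \<Longrightarrow> h < d \<Longrightarrow> f (t - h) - g (t - h) < f t - g t"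
    by blast
  define h where "h = min d r / 2"
  have "0 < h" "h < d" "h < r"
    using d(1) \<open>r > 0\<close> by (auto simp: h_def min_def)
  then show False
    using d(2)[of h] min[of "t - h"] by simp
qed

lemma barrier_strict_subsolution:
  fixes p \<beta> M b g s X n t\<^sub>0 :: real
  assumes p: "p > 1" and \<beta>: "\<beta> = 1 / (p - 1)" and X: "X > 0" and t\<^sub>0: "t\<^sub>0 > 0" and M: "M > 0"
    and b: "b = 24 * M / (7 * t\<^sub>0)"
    and g: "M / 2 \<le> g" "g \<le> 4 * M" and s: "0 \<le> s" "s \<le> 1"
    and n: "n \<ge> 0" "112 * n * t\<^sub>0 < 3 * X\<^sup>2"
    and large: "4 * M / t\<^sub>0 \<le> (M / 4) powr p"
  shows "X powr (\<beta> + 1) * (- (b / 8) + b * s\<^sup>2) + 2 * (X powr (\<beta> + 1) * g / X\<^sup>2) * n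
    < (2 * (X powr (\<beta> + 1) * g / X\<^sup>2) * (X * s)) powr p"
proof -
  have b_pos: "b > 0"
    using b M t\<^sub>0 by simp
  have visc: "2 * g * n / X\<^sup>2 < b / 16"
  proof -
    have "2 * g * n / X\<^sup>2 \<le> 8 * M * n / X\<^sup>2"
      using mult_right_mono[OF g(2) n(1)] X by (intro divide_right_mono) auto
    also have "\<dots> < b / 16"
      using mult_strict_left_mono[OF n(2) M] X t\<^sub>0 by (simp add: b divide_simps algebra_simps)
    finally show ?thesis .
  qed
  have reduced: "- (b / 8) + b * s\<^sup>2 + 2 * g * n / X\<^sup>2 < (2 * g * s) powr p"
  proof (cases "s < 1 / 4")
    case True
    have "s\<^sup>2 \<le> 1 / 16"
      using power_mono[of s "1/4" 2] True s by (simp add: power_divide)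
    then have "b * s\<^sup>2 \<le> b / 16"
      using mult_left_mono[of "s\<^sup>2" "1/16" b] b_pos by simp
    then have "- (b / 8) + b * s\<^sup>2 + 2 * g * n / X\<^sup>2 < 0"
      using visc by linarith
    then show ?thesis
      by (rule order.strict_trans2) simp
  next
    case False
    have "b * s\<^sup>2 \<le> b"
      using s b_pos mult_left_mono[of "s\<^sup>2" 1 b] by (simp add: power_le_one)
    then have "- (b / 8) + b * s\<^sup>2 + 2 * g * n / X\<^sup>2 < b"
      using visc b_pos by linarith
    also have "b \<le> 4 * M / t\<^sub>0"
      using M t\<^sub>0 by (simp add: b divide_simps)
    also note large
    also have "M / 4 \<le> 2 * g * s"
      using mult_mono[of "M / 2" g "1 / 4" s] False g M by simp
    then have "(M / 4) powr p \<le> (2 * g * s) powr p"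
      using M p by (intro powr_mono2) auto
    finally show ?thesis .
  qed
  have exps: "\<beta> * p = \<beta> + 1"
    using p by (simp add: \<beta> field_simps)
  have "2 * (X powr (\<beta> + 1) * g / X\<^sup>2) * (X * s) = X powr \<beta> * (2 * g * s)"
    using X by (simp add: powr_add power2_eq_square field_simps)
  then have rhs: "(2 * (X powr (\<beta> + 1) * g / X\<^sup>2) * (X * s)) powr p
      = X powr (\<beta> + 1) * (2 * g * s) powr p"
    using g M s by (simp add: powr_mult powr_powr exps)
  have "X powr (\<beta> + 1) * (- (b / 8) + b * s\<^sup>2) + 2 * (X powr (\<beta> + 1) * g / X\<^sup>2) * n
      = X powr (\<beta> + 1) * (- (b / 8) + b * s\<^sup>2 + 2 * g * n / X\<^sup>2)"
    by (simp add: algebra_simps)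
  also have "\<dots> < X powr (\<beta> + 1) * (2 * g * s) powr p"
    using reduced X by simp
  finally show ?thesis
    by (simp only: rhs)
qed

lemma closure_half_space: "closure (half_space k) = {x :: real ^ 'n::finite. x $ k \<ge> 0}"
proof -
  have "half_space k = {x :: real ^ 'n. axis k 1 \<bullet> x > 0}"
    by (simp add: half_space_def inner_axis')
  then show ?thesis
    using closure_halfspace_gt[of "axis k 1 :: real ^ 'n" 0] by (simp add: inner_axis')
qed

lemma open_half_space: "open (half_space k :: (real ^ 'n::finite) set)"
  unfolding half_space_def by (intro open_Collect_less continuous_intros)

lemma solution_lower_bound:
  fixes k :: "'n::finite" and u :: "(real ^ 'n) \<times> real \<Rightarrow> real"
  assumes p: "p > 1" and \<beta>: "\<beta> = 1 / (p - 1)"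
    and sol: "classical_solution k p T u0 u"
    and nonneg: "\<And>z. z \<in> closed_cylinder k T \<Longrightarrow> u z \<ge> 0"
    and t\<^sub>0: "0 < t\<^sub>0" "t\<^sub>0 < T" and M: "M > 0" and X: "X \<ge> 1"
    and X_large: "112 * real CARD('n) * t\<^sub>0 < 3 * X\<^sup>2"
    and M_large: "4 * M / t\<^sub>0 \<le> (M / 4) powr p"
    and init: "\<And>x. x $ k \<ge> X / 2 \<Longrightarrow> u0 x \<ge> M * X powr (\<beta> + 1)"
  shows "u (axis k 1, t\<^sub>0) \<ge> 4 * M / 7 * X powr \<beta>"
proof -
  define z :: "real ^ 'n" where "z = X *\<^sub>R axis k 1"
  \<comment> \<open>This rate makes \<open>m t\<^sub>0 = g t\<^sub>0\<close>, so the support has radius exactly \<open>X\<close> at time \<open>t\<^sub>0\<close>.\<close>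
  define b where "b = 24 * M / (7 * t\<^sub>0)"
  define A where "A = X powr (\<beta> + 1)"
  define m where "m t = M - b / 8 * t" for t
  define g where "g t = 4 * M - b * t" for t
  define v where "v x t = A * (m t - g t * (norm (x - z) / X)\<^sup>2)" for x t
  let ?K = "cball z X \<times> {0..t\<^sub>0}"
  have A: "A > 0"
    using X by (simp add: A_def)
  have b: "b > 0" "b * t\<^sub>0 = 24 * M / 7"
    using M t\<^sub>0 by (simp_all add: b_def)
  have bt: "0 \<le> b * t" "b * t \<le> 24 * M / 7" if "t \<in> {0..t\<^sub>0}" for t
    using that b(1) mult_left_mono[of t t\<^sub>0 b] unfolding b(2)[symmetric] by auto
  have g: "M / 2 \<le> g t" "g t \<le> 4 * M" "m t \<le> g t" if "t \<in> {0..t\<^sub>0}" for t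
    using bt[OF that] M by (simp_all add: g_def m_def)
  have coord: "\<bar>x $ k - X\<bar> \<le> norm (x - z)" for x
    using component_le_norm_cart[of "x - z" k] by (simp add: z_def)
  have K: "?K \<subseteq> closed_cylinder k T"
  proof (clarsimp simp: closed_cylinder_def closure_half_space dist_norm)
    fix x t assume "norm (z - x) \<le> X" "0 \<le> t" "t \<le> t\<^sub>0"
    then show "0 \<le> x $ k \<and> t \<le> T"
      using coord[of x] t\<^sub>0 by (simp add: norm_minus_commute)
  qed
  have cont: "continuous_on ?K (\<lambda>w. u w - v (fst w) (snd w))"
  proof -
    have "continuous_on ?K u"
      using sol K unfolding classical_solution_def by (blast intro: continuous_on_subset)
    then show ?thesis
      unfolding v_def m_def g_def using X by (intro continuous_intros) auto
  qed
  have compact: "compact ?K"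
    by (intro compact_Times) auto
  have "?K \<noteq> {}"
    using X t\<^sub>0 by auto
  then obtain w where w: "w \<in> ?K"
    "\<And>w'. w' \<in> ?K \<Longrightarrow> u w - v (fst w) (snd w) \<le> u w' - v (fst w') (snd w')"
    using continuous_attains_inf[OF compact _ cont] by blast
  obtain x t where xt: "w = (x, t)"
    by (cases w)
  have t: "t \<in> {0..t\<^sub>0}"
    using w(1) xt by simp
  define s where "s = norm (x - z) / X"
  have min: "u (x, t) - v x t \<le> u (y, t') - v y t'" if "y \<in> cball z X" "t' \<in> {0..t\<^sub>0}" for y t'
    using w(2)[of "(y, t')"] that by (simp add: xt)
  have "u (x, t) - v x t \<ge> 0"
  proof (rule ccontr)
    assume neg: "\<not> ?thesis"
    have "u (x, t) \<ge> 0"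
      using nonneg K w(1) xt by blast
    then have "v x t > 0"
      using neg by simp
    then have pos: "g t * s\<^sup>2 < m t"
      using A by (simp add: v_def s_def zero_less_mult_iff)
    have s0: "s \<ge> 0"
      using X by (simp add: s_def)
    have s1: "s < 1"
    proof (rule ccontr)
      assume "\<not> s < 1"
      then have "g t * 1 \<le> g t * s\<^sup>2"
        using g(1)[OF t] M by (intro mult_left_mono) (auto simp: one_le_power)
      then show False
        using pos g(3)[OF t] by simp
    qed
    have sX: "norm (x - z) = X * s"
      using X by (simp add: s_def)
    then have xball: "norm (x - z) < X"
      using s1 X by simp
    have xH: "x \<in> half_space k"
      using coord[of x] xball by (simp add: half_space_def)
    have "t \<noteq> 0"
    proof
      assume t0: "t = 0"
      have "s\<^sup>2 < (1 / 2)\<^sup>2"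
        using pos M by (simp add: t0 m_def g_def power2_eq_square)
      then have "s < 1 / 2"
        by (rule power_less_imp_less_base) simp
      then have "norm (x - z) < X / 2"
        using X by (simp add: s_def divide_simps)
      then have "x $ k \<ge> X / 2"
        using coord[of x] by linarith
      then have "u (x, 0) \<ge> M * A"
        using init[of x] xH sol by (simp add: A_def classical_solution_def)
      moreover have "v x 0 \<le> A * M"
        using M A by (auto simp: v_def m_def g_def intro!: mult_left_mono)
      ultimately show False
        using neg t0 by (simp add: mult.commute)
    qed
    then have tpos: "0 < t" "t \<le> t\<^sub>0" "t < T"
      using t t\<^sub>0 by auto
    define C where "C = A * g t / X\<^sup>2"
    have v_eq: "v y t = A * m t - C * (norm (y - z))\<^sup>2" for y
      by (simp add: v_def C_def power_divide algebra_simps)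
    have "open (half_space k \<inter> ball z X)"
      by (intro open_Int open_half_space open_ball)
    moreover have "x \<in> half_space k \<inter> ball z X"
      using xH xball by (simp add: dist_norm norm_minus_commute)
    ultimately obtain r where r: "r > 0" "ball x r \<subseteq> half_space k \<inter> ball z X"
      by (rule openE)
    have C21: "C21_on (cylinder k T) u"
      using sol by (simp add: classical_solution_def)
    have cyl: "(y, t) \<in> cylinder k T" if "y \<in> half_space k" for y
      using that tpos by (simp add: cylinder_def)
    have d1: "has_pdx i (\<lambda>y. u (y, t)) y" if "y \<in> ball x r" for i y
      using C21 cyl[of y] r(2) that unfolding C21_on_def by blast
    have d2: "has_pdx i (pdx i (\<lambda>y. u (y, t))) x" for i
      using C21 cyl[OF xH] unfolding C21_on_def by blast
    have touch: "u (x, t) + C * (norm (x - z))\<^sup>2 \<le> u (y, t) + C * (norm (y - z))\<^sup>2"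
      if "y \<in> ball x r" for y
    proof -
      have "y \<in> cball z X"
        using r(2) that ball_subset_cball by blast
      then show ?thesis
        using min[of y t] t by (simp add: v_eq)
    qed
    have space: "gradient (\<lambda>y. u (y, t)) x = (- 2 * C) *\<^sub>R (x - z)"
      "laplacian (\<lambda>y. u (y, t)) x \<ge> - 2 * C * real CARD('n)"
      by (rule gradient_laplacian_touching_paraboloid[OF r(1) d1 d2 touch]; assumption)+
    have C: "C \<ge> 0"
      using A g(1)[OF t] M by (simp add: C_def)
    have grad: "norm (gradient (\<lambda>y. u (y, t)) x) = 2 * C * (X * s)"
      using C by (simp add: space(1) sX)
    have du: "((\<lambda>t. u (x, t)) has_real_derivative time_deriv u x t) (at t)"
      using C21 cyl[OF xH] unfolding C21_on_def time_deriv_def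
      by (auto intro: field_differentiable_derivI)
    have dv: "((\<lambda>t. v x t) has_real_derivative A * (- (b / 8) + b * s\<^sup>2)) (at t)"
      unfolding v_def m_def g_def s_def
      by (auto intro!: derivative_eq_intros simp: algebra_simps)
    have "time_deriv u x t \<le> A * (- (b / 8) + b * s\<^sup>2)"
    proof (rule DERIV_le_of_left_min[OF tpos(1) du dv])
      fix t' assume "t - t < t'" "t' \<le> t"
      then show "u (x, t) - v x t \<le> u (x, t') - v x t'"
        using min[of x t'] tpos w(1) xt by simp
    qed
    then have "time_deriv u x t - laplacian (\<lambda>y. u (y, t)) x
        \<le> A * (- (b / 8) + b * s\<^sup>2) + 2 * C * real CARD('n)"
      using space(2) by simp
    also have "\<dots> < (2 * C * (X * s)) powr p"
      using barrier_strict_subsolution[OF p \<beta> _ t\<^sub>0(1) M b_def g(1,2)[OF t] s0 _ _ X_large M_large]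
        X s1 by (simp add: A_def C_def)
    finally have "time_deriv u x t - laplacian (\<lambda>y. u (y, t)) x
        < norm (gradient (\<lambda>y. u (y, t)) x) powr p"
      by (simp add: grad)
    moreover have "time_deriv u x t - laplacian (\<lambda>y. u (y, t)) x
        = norm (gradient (\<lambda>y. u (y, t)) x) powr p"
      using sol xH tpos unfolding classical_solution_def by auto
    ultimately show False
      by simp
  qed
  moreover have norm_e: "norm (axis k 1 - z) = X - 1"
  proof -
    have "axis k 1 - z = (1 - X) *\<^sub>R axis k 1"
      by (simp add: z_def algebra_simps)
    then show ?thesis
      using X by simp
  qed
  then have "axis k 1 \<in> cball z X"
    by (simp add: dist_norm norm_minus_commute)
  ultimately have "v (axis k 1) t\<^sub>0 \<le> u (axis k 1, t\<^sub>0)"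
    using min[of "axis k 1" t\<^sub>0] t\<^sub>0 by simp
  moreover have "4 * M / 7 * X powr \<beta> \<le> v (axis k 1) t\<^sub>0"
  proof -
    have "v (axis k 1) t\<^sub>0 = A * (4 * M / 7) * (1 - ((X - 1) / X)\<^sup>2)"
      using b(2) by (simp add: v_def m_def g_def norm_e algebra_simps)
    moreover have "1 - ((X - 1) / X)\<^sup>2 \<ge> 1 / X"
      using X by (simp add: divide_simps power2_eq_square algebra_simps)
    ultimately have "A * (4 * M / 7) * (1 / X) \<le> v (axis k 1) t\<^sub>0"
      using A M by (simp del: times_divide_eq_right times_divide_eq_left)
    then show ?thesis
      using X by (simp add: A_def powr_add mult.commute)
  qed
  ultimately show ?thesis
    by simp
qed

theorem theorem2p3:
  fixes k :: "'n::finite"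
    and p \<beta> T :: real
    and u0 :: "real ^ 'n \<Rightarrow> real"
  assumes "p > 1"
    and "\<beta> = 1 / (p - 1)"
    and "continuous_on (closure (half_space k)) u0"
    and "tends_to_infinity_unif k (\<lambda>x. (x $ k) powr (- \<beta> - 1) * u0 x)"
    and "T > 0"
  shows "\<not> (\<exists>u :: (real ^ 'n) \<times> real \<Rightarrow> real.
            classical_solution k p T u0 u \<and>
            (\<forall>z\<in>closed_cylinder k T. u z \<ge> 0))"
proof
  assume "\<exists>u. classical_solution k p T u0 u \<and> (\<forall>z\<in>closed_cylinder k T. u z \<ge> 0)"
  then obtain u where sol: "classical_solution k p T u0 u"
    and nonneg: "\<And>z. z \<in> closed_cylinder k T \<Longrightarrow> u z \<ge> 0"
    by blast
  have \<beta>: "\<beta> > 0"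
    using assms by simp
  define t\<^sub>0 where "t\<^sub>0 = T / 2"
  have t\<^sub>0: "0 < t\<^sub>0" "t\<^sub>0 < T"
    using \<open>T > 0\<close> by (simp_all add: t\<^sub>0_def)
  \<comment> \<open>The equality case of \<open>4 * M / t\<^sub>0 \<le> (M / 4) powr p\<close>.\<close>
  define M where "M = 4 * (16 / t\<^sub>0) powr \<beta>"
  have M: "M > 0"
    using t\<^sub>0 by (simp add: M_def)
  have "\<beta> * p = \<beta> + 1"
    using assms(1,2) by (simp add: field_simps)
  then have M_large: "4 * M / t\<^sub>0 \<le> (M / 4) powr p"
    using t\<^sub>0 by (simp add: M_def powr_powr powr_add mult.commute)
  obtain R where R: "\<And>x. x \<in> half_space k \<Longrightarrow> x $ k \<ge> R \<Longrightarrow>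
      (x $ k) powr (- \<beta> - 1) * u0 x \<ge> M * 2 powr (\<beta> + 1)"
    using assms(4) unfolding tends_to_infinity_unif_def by metis
  have u0: "u0 x \<ge> M * X powr (\<beta> + 1)" if "X \<ge> 1" "X \<ge> 2 * R" "x $ k \<ge> X / 2" for X x
  proof -
    have xk: "x $ k > 0"
      using that by linarith
    then have "M * 2 powr (\<beta> + 1) \<le> (x $ k) powr (- (\<beta> + 1)) * u0 x"
      using R[of x] that by (simp add: half_space_def)
    then have "M * 2 powr (\<beta> + 1) * (x $ k) powr (\<beta> + 1) \<le> u0 x"
      using xk by (simp add: powr_minus divide_simps mult.commute flip: minus_add_distrib)
    moreover have "X powr (\<beta> + 1) \<le> (2 * x $ k) powr (\<beta> + 1)"
      using that \<beta> by (intro powr_mono2) auto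
    then have "M * X powr (\<beta> + 1) \<le> M * (2 powr (\<beta> + 1) * (x $ k) powr (\<beta> + 1))"
      using M xk by (simp add: powr_mult)
    ultimately show ?thesis
      by simp
  qed
  define Y where "Y = 7 / (4 * M) * (\<bar>u (axis k 1, t\<^sub>0)\<bar> + 1)"
  have Y: "Y \<ge> 0"
    using M by (simp add: Y_def)
  define X where "X = Max {1, 2 * R, 112 * real CARD('n) * t\<^sub>0, Y powr (1 / \<beta>)}"
  have X: "X \<ge> 1" "X \<ge> 2 * R" "X \<ge> 112 * real CARD('n) * t\<^sub>0" "X \<ge> Y powr (1 / \<beta>)"
    by (simp_all add: X_def)
  have "X \<le> X\<^sup>2"
    using X(1) by (simp add: self_le_power)
  then have "112 * real CARD('n) * t\<^sub>0 < 3 * X\<^sup>2"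
    using X(1,3) by linarith
  then have "4 * M / 7 * X powr \<beta> \<le> u (axis k 1, t\<^sub>0)"
    using solution_lower_bound[OF assms(1,2) sol nonneg t\<^sub>0 M X(1) _ M_large u0[OF X(1,2)]]
    by blast
  moreover have "Y \<le> X powr \<beta>"
    using powr_mono2[OF _ _ X(4), of \<beta>] \<beta> Y by (simp add: powr_powr)
  then have "4 * M / 7 * Y \<le> 4 * M / 7 * X powr \<beta>"
    using M by (intro mult_left_mono) auto
  moreover have "4 * M / 7 * Y = \<bar>u (axis k 1, t\<^sub>0)\<bar> + 1"
    using M by (simp add: Y_def)
  ultimately show False
    by linarith
qed

end
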